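(* Fix a time $k$ and a Pareto weighting factor $\rho_{1,k}\in[0,1]$. Let the estimation error be $$w_{x_{1,k+1}}=(1-\beta_{1,k})\,w^{(r)}_{x_{1,k+1}}+\beta_{1,k}\,w_{x_{1,k}}+\beta_{1,k}T\tilde V_k\cos\tilde\phi_k-\beta_{1,k}TV_k\cos\phi_k ,$$ with mean $\mu(\beta_{1,k})=\mathbb{E}\{w_{x_{1,k+1}}\}$ and variance $\sigma^2(\beta_{1,k})=\mathbb{E}\{(w_{x_{1,k+1}}-\mathbb{E}\{w_{x_{1,k+1}}\})^2\}$. Consider the optimization problem $$\min_{\beta_{1,k}\in[-1,1]}\ \rho_{1,k}\,\mu(\beta_{1,k})^2+(1-\rho_{1,k})\,\sigma^2(\beta_{1,k}).$$ Define $$\eta=\sigma_{v_r}^2+\sigma_{v_x}^2+\sigma_{v_v}^2,\qquad \gamma=-\mathbb{E}\{w^{(r)}_{x_{1,k+1}}\}+\mathbb{E}\{w_{x_{1,k}}\}+TV_k\cos(\phi_k)\left(e^{-\sigma_\phi^2/2}-1\right),$$ and assume $(1-\rho_{1,k})\eta+\rho_{1,k}\gamma^2\neq 0$. Then the optimal solution is $$\beta_{1,k}^*(\rho_{1,k})=\max\left(-1,\min(\xi,1)\right),\qquad \xi=\frac{2(1-\rho_{1,k})\sigma_{v_r}^2-2\rho_{1,k}\gamma\,\mathbb{E}\{w^{(r)}_{x_{1,k+1}}\}}{2(1-\rho_{1,k})\eta+2\rho_{1,k}\gamma^2}.$$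
   Context: $T>0$ is the sampling interval and $V_k,\phi_k$ are deterministic real numbers (true speed and orientation). The measurements are $\tilde V_k=V_k+w_{V,k}$ and $\tilde\phi_k=\phi_k+w_{\phi,k}$, where $w_{V,k},w_{\phi,k}$ are independent zero-mean Gaussian random variables with variances $\sigma_V^2,\sigma_\phi^2$. The square-integrable real random variables $w^{(r)}_{x_{1,k+1}}$ (error of the ranging-based position estimate at time $k+1$) and $w_{x_{1,k}}$ (position estimation error at time $k$) and the pair $(\tilde V_k,\tilde\phi_k)$ are mutually independent. The coefficient $\beta_{1,k}$ is deterministic. The centered variables are $v_r=w^{(r)}_{x_{1,k+1}}-\mathbb{E}\{w^{(r)}_{x_{1,k+1}}\}$, $v_x=w_{x_{1,k}}-\mathbb{E}\{w_{x_{1,k}}\}$, $v_v=T\tilde V_k\cos\tilde\phi_k-TV_k\cos(\phi_k)e^{-\sigma_\phi^2/2}$, with variances $\sigma_{v_r}^2,\sigma_{v_x}^2,\sigma_{v_v}^2$. *)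

theory Defs
  imports "HOL-Probability.Probability"
begin

text \<open>The Gaussian law with mean \<open>m\<close> and standard deviation \<open>s\<close>. For \<open>s = 0\<close> the library's
  \<open>normal_density\<close> is identically zero, so the degenerate law is given as a point mass.\<close>

definition gaussian_law :: "real \<Rightarrow> real \<Rightarrow> real measure" where
  "gaussian_law m s = (if s = 0 then return borel m else density lborel (normal_density m s))"

definition gaussian_rv :: "'a measure \<Rightarrow> ('a \<Rightarrow> real) \<Rightarrow> real \<Rightarrow> real \<Rightarrow> bool" where
  "gaussian_rv M X m s \<longleftrightarrow> X \<in> borel_measurable M \<and> distr M borel X = gaussian_law m s"

text \<open>Mutual independence of three random variables. The library's \<open>indep_vars\<close> requires all
  variables of the family to take values in one type; its definition is transcribed here for
  three value types.\<close>

definition indep_vars3 ::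
  "'a measure \<Rightarrow> 'b measure \<Rightarrow> ('a \<Rightarrow> 'b) \<Rightarrow> 'c measure \<Rightarrow> ('a \<Rightarrow> 'c)
     \<Rightarrow> 'd measure \<Rightarrow> ('a \<Rightarrow> 'd) \<Rightarrow> bool" where
  "indep_vars3 M N1 X1 N2 X2 N3 X3 \<longleftrightarrow>
     X1 \<in> measurable M N1 \<and> X2 \<in> measurable M N2 \<and> X3 \<in> measurable M N3 \<and>
     prob_space.indep_sets M
       (\<lambda>i::nat. if i = 0 then {X1 -` A \<inter> space M | A. A \<in> sets N1}
                 else if i = 1 then {X2 -` A \<inter> space M | A. A \<in> sets N2}
                 else {X3 -` A \<inter> space M | A. A \<in> sets N3})
       {0, 1, 2}"

end

theory Submission
  imports Defs
begin

text \<open>Since \<open>E cos(\<phi> + Z) = exp(-\<sigma>\<^sup>2/2) cos \<phi>\<close> for a centered Gaussian \<open>Z\<close> with variance \<open>\<sigma>\<^sup>2\<close>,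
  the mean of the estimation error is \<open>E w\<^sub>r + \<beta>\<gamma>\<close>. By independence its variance is
  \<open>(1-\<beta>)\<^sup>2 Var v\<^sub>r + \<beta>\<^sup>2 Var v\<^sub>x + \<beta>\<^sup>2 Var v\<^sub>v\<close>. The cost is therefore a quadratic polynomial in \<open>\<beta>\<close>
  with leading coefficient \<open>(1-\<rho>)\<eta> + \<rho>\<gamma>\<^sup>2 > 0\<close> and vertex \<open>\<xi>\<close>, so its unique minimizer on an
  interval is the projection of \<open>\<xi>\<close>.\<close>

text \<open>Because \<open>D > 0\<close>, \<open>f\<close> orders points by their distance to
  \<open>\<xi>\<close>. The projection is strictly closer to \<open>\<xi>\<close> than any other
  point of the interval, and this strictness yields the equivalence rather than mere
  existence.\<close>

lemma is_arg_min_quadratic_interval: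
  fixes f :: "real \<Rightarrow> real"
  assumes f: "\<And>x. f x = c + D * (x - \<xi>)\<^sup>2" and "D > 0" and "a \<le> b"
  shows "is_arg_min f (\<lambda>x. x \<in> {a..b}) x \<longleftrightarrow> x = max a (min \<xi> b)"
proof -
  let ?p = "max a (min \<xi> b)"
  have less: "f u < f v \<longleftrightarrow> \<bar>u - \<xi>\<bar> < \<bar>v - \<xi>\<bar>" for u v
    using \<open>D > 0\<close> abs_le_square_iff[of "v - \<xi>" "u - \<xi>"] by (simp add: f) linarith
  have p: "?p \<in> {a..b}" using \<open>a \<le> b\<close> by auto
  have "f ?p < f y" if "y \<in> {a..b}" "y \<noteq> ?p" for y
    using that unfolding less by (auto simp: max_def min_def abs_if split: if_splits)
  then show ?thesis
    using p unfolding is_arg_min_def by (metis less_asym less_irrefl)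
qed

section \<open>Moments and characteristic function of Gaussian variables, point masses
  included\<close>

lemma gaussian_rv_distributed:
  assumes "gaussian_rv M X m s" and "s \<noteq> 0"
  shows "distributed M lborel X (normal_density m s)"
  \<comment> \<open>\<open>distributed\<close> speaks of \<open>distr M lborel X\<close> and
    \<open>gaussian_rv\<close> of \<open>distr M borel X\<close>; these agree since
    \<open>lborel\<close> and \<open>borel\<close> have the same measurable sets.\<close>
  using assms by (auto simp: gaussian_rv_def gaussian_law_def distributed_def cong: distr_cong)

lemma (in prob_space) gaussian_rv_degenerate:
  assumes "gaussian_rv M X m 0"
  shows "AE x in M. X x = m"
proof -
  have X: "X \<in> borel_measurable M" and D: "distr M borel X = return borel m"
    using assms by (auto simp: gaussian_rv_def gaussian_law_def)
  have "AE x in distr M borel X. x = m"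
    unfolding D by (subst AE_return) auto
  then show ?thesis using X by (subst (asm) AE_distr_iff) auto
qed

lemma (in prob_space) gaussian_rv_square_integrable:
  assumes G: "gaussian_rv M X 0 s" and "s \<ge> 0"
  shows "integrable M (\<lambda>x. (X x)\<^sup>2)"
proof (cases "s = 0")
  case True
  have "X \<in> borel_measurable M" using G by (simp add: gaussian_rv_def)
  moreover have "AE x in M. (X x)\<^sup>2 = 0"
    using gaussian_rv_degenerate[of X 0] G True by auto
  ultimately show ?thesis
    by (subst integrable_cong_AE[where g = "\<lambda>_. 0"]) auto
next
  case False
  note D = gaussian_rv_distributed[OF G False]
  show ?thesis
    using distributed_integrable[OF D, of "\<lambda>x. x\<^sup>2"] integrable_normal_moment[of s 0 2] False \<open>s \<ge> 0\<close>
    by simp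
qed

lemma (in prob_space) gaussian_rv_expectation:
  assumes G: "gaussian_rv M X 0 s" and "s \<ge> 0"
  shows "expectation X = 0"
proof (cases "s = 0")
  case True
  have "X \<in> borel_measurable M" using G by (simp add: gaussian_rv_def)
  moreover have "AE x in M. X x = 0"
    using gaussian_rv_degenerate[of X 0] G True by auto
  ultimately show ?thesis
    by (subst integral_cong_AE[where g = "\<lambda>_. 0"]) auto
next
  case False
  then show ?thesis
    using normal_distributed_expectation[OF _ gaussian_rv_distributed[OF G False]] \<open>s \<ge> 0\<close> by simp
qed

text \<open>For \<open>s > 0\<close> the variable \<open>X / s\<close> is standard normal, with
  characteristic function \<open>exp (- t\<^sup>2 / 2)\<close>; evaluating it at
  \<open>t = s\<close> undoes the scaling. For \<open>s = 0\<close> the integrand is 1 almost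
  everywhere.\<close>

lemma (in prob_space) gaussian_rv_expectation_iexp:
  assumes G: "gaussian_rv M X 0 s" and "s \<ge> 0"
  shows "(CLINT x|M. iexp (X x)) = of_real (exp (- s\<^sup>2 / 2))"
proof (cases "s = 0")
  case True
  have [measurable]: "X \<in> borel_measurable M" using G by (simp add: gaussian_rv_def)
  have "(CLINT x|M. iexp (X x)) = (CLINT x|M. 1)"
    using gaussian_rv_degenerate[of X 0] G True
    by (intro integral_cong_AE) auto
  then show ?thesis using True by (simp add: prob_space)
next
  case False
  then have s: "s > 0" using \<open>s \<ge> 0\<close> by simp
  have [measurable]: "X \<in> borel_measurable M" using G by (simp add: gaussian_rv_def)
  have "distributed M lborel (\<lambda>x. X x / s) std_normal_density"
    using gaussian_rv_distributed[OF G False] normal_standard_normal_convert[OF s, of X 0] by simp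
  then have D: "distr M borel (\<lambda>x. X x / s) = std_normal_distribution"
    by (simp add: distributed_def cong: distr_cong)
  have "(CLINT x|M. iexp (X x)) = char (distr M borel (\<lambda>x. X x / s)) s"
    unfolding char_def by (subst integral_distr) (use s in auto)
  then show ?thesis by (simp add: D char_std_normal_distribution)
qed

text \<open>The cosine is the real part of \<open>iexp a * iexp (X x)\<close>. The constant phase
  \<open>iexp a\<close> leaves the integral and the remaining factor has a real expectation, so only
  its real part \<open>cos a\<close> survives.\<close>

lemma (in prob_space) gaussian_rv_expectation_cos:
  assumes G: "gaussian_rv M X 0 s" and "s \<ge> 0"
  shows "expectation (\<lambda>x. cos (a + X x)) = cos a * exp (- s\<^sup>2 / 2)"
proof -
  have [measurable]: "X \<in> borel_measurable M" using G by (simp add: gaussian_rv_def)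
  have int: "complex_integrable M (\<lambda>x. iexp (X x))"
    by (rule integrable_iexp) auto
  have "expectation (\<lambda>x. cos (a + X x)) = (LINT x|M. Re (iexp a * iexp (X x)))"
    by (intro Bochner_Integration.integral_cong) (auto simp: Re_exp simp flip: exp_add)
  also have "\<dots> = Re (CLINT x|M. iexp a * iexp (X x))"
    using int by (intro integral_Re) auto
  also have "\<dots> = Re (iexp a * of_real (exp (- s\<^sup>2 / 2)))"
    using int gaussian_rv_expectation_iexp[OF assms] by simp
  also have "\<dots> = cos a * exp (- s\<^sup>2 / 2)"
    by (simp add: Re_exp)
  finally show ?thesis .
qed

section \<open>From mutual independence of three variables to independence of pairs\<close>

lemma Int_stable_vimages: "Int_stable {X -` A \<inter> S | A. A \<in> sets N}"
proof (rule Int_stableI)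
  fix U W assume "U \<in> {X -` A \<inter> S | A. A \<in> sets N}" "W \<in> {X -` A \<inter> S | A. A \<in> sets N}"
  then obtain A B where "A \<in> sets N" "B \<in> sets N" "U = X -` A \<inter> S" "W = X -` B \<inter> S"
    by auto
  then show "U \<inter> W \<in> {X -` A \<inter> S | A. A \<in> sets N}"
    by (intro CollectI exI[of _ "A \<inter> B"]) auto
qed

text \<open>Independence of variables is independence of the sigma-algebras generated by their
  preimages. These preimages form intersection-stable systems, so the product rule on generators
  extends to the sigma-algebras.\<close>

lemma (in prob_space) indep_var_vimageI:
  assumes X: "random_variable S X" and Y: "random_variable N Y"
    and prob: "\<And>A B. A \<in> sets S \<Longrightarrow> B \<in> sets N \<Longrightarrow>
      prob ((X -` A \<inter> space M) \<inter> (Y -` B \<inter> space M))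
        = prob (X -` A \<inter> space M) * prob (Y -` B \<inter> space M)"
  shows "indep_var S X N Y"
  unfolding indep_var_eq using X Y prob
  by (intro conjI indep_set_sigma_sets indep_setI Int_stable_vimages) auto

lemma vimages_comp_subset:
  assumes X: "X \<in> measurable M N" and f: "f \<in> measurable N K"
  shows "{(f \<circ> X) -` A \<inter> space M | A. A \<in> sets K} \<subseteq> {X -` A \<inter> space M | A. A \<in> sets N}"
proof safe
  fix A assume "A \<in> sets K"
  then have "f -` A \<inter> space N \<in> sets N" using f by (rule measurable_sets[rotated])
  moreover have "(f \<circ> X) -` A \<inter> space M = X -` (f -` A \<inter> space N) \<inter> space M"
    using measurable_space[OF X] by auto
  ultimately show "\<exists>B. (f \<circ> X) -` A \<inter> space M = X -` B \<inter> space M \<and> B \<in> sets N" by blast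
qed

text \<open>A preimage under a composition is already a preimage under the inner map, so composing
  only shrinks the three set systems, and independence passes to subsystems. Below, this turns the
  measured pair into a real displacement, so that all three value types agree.\<close>

lemma (in prob_space) indep_vars3_compose:
  assumes "indep_vars3 M N1 X1 N2 X2 N3 X3"
    and f: "f1 \<in> measurable N1 K1" "f2 \<in> measurable N2 K2" "f3 \<in> measurable N3 K3"
  shows "indep_vars3 M K1 (f1 \<circ> X1) K2 (f2 \<circ> X2) K3 (f3 \<circ> X3)"
proof -
  have X: "X1 \<in> measurable M N1" "X2 \<in> measurable M N2" "X3 \<in> measurable M N3"
    and F: "indep_sets (\<lambda>i::nat. if i = 0 then {X1 -` A \<inter> space M | A. A \<in> sets N1}
                 else if i = 1 then {X2 -` A \<inter> space M | A. A \<in> sets N2}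
                 else {X3 -` A \<inter> space M | A. A \<in> sets N3}) {0, 1, 2}"
    using assms(1) unfolding indep_vars3_def by blast+
  have "indep_sets (\<lambda>i::nat. if i = 0 then {(f1 \<circ> X1) -` A \<inter> space M | A. A \<in> sets K1}
                 else if i = 1 then {(f2 \<circ> X2) -` A \<inter> space M | A. A \<in> sets K2}
                 else {(f3 \<circ> X3) -` A \<inter> space M | A. A \<in> sets K3}) {0, 1, 2}"
    using vimages_comp_subset[OF X(1) f(1)] vimages_comp_subset[OF X(2) f(2)]
      vimages_comp_subset[OF X(3) f(3)]
    by (intro indep_sets_mono_sets[OF F]) (simp split: if_split)
  then show ?thesis
    unfolding indep_vars3_def using X f by (blast intro: measurable_comp)
qed

text \<open>All three value types coincide because \<open>indep_var\<close> demands it.\<close>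

lemma (in prob_space) indep_vars3_pairwise:
  fixes X1 X2 X3 :: "'a \<Rightarrow> 'b"
  assumes "indep_vars3 M N1 X1 N2 X2 N3 X3"
  shows "indep_var N1 X1 N2 X2" and "indep_var N1 X1 N3 X3" and "indep_var N2 X2 N3 X3"
proof -
  define F where "F = (\<lambda>i::nat. if i = 0 then {X1 -` A \<inter> space M | A. A \<in> sets N1}
                 else if i = 1 then {X2 -` A \<inter> space M | A. A \<in> sets N2}
                 else {X3 -` A \<inter> space M | A. A \<in> sets N3})"
  have X: "X1 \<in> measurable M N1" "X2 \<in> measurable M N2" "X3 \<in> measurable M N3"
    and F: "indep_sets F {0, 1, 2}"
    using assms unfolding indep_vars3_def F_def by blast+
  have pair: "prob (U \<inter> W) = prob U * prob W"
    if "i \<in> {0, 1, 2}" "j \<in> {0, 1, 2}" "i \<noteq> j" "U \<in> F i" "W \<in> F j" for i j U W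
    \<comment> \<open>Independence over the index subset \<open>{i, j}\<close>, with
      \<open>U\<close> chosen at \<open>i\<close> and \<open>W\<close> at \<open>j\<close>.\<close>
    using indep_setsD[OF F, of "{i, j}" "\<lambda>l. if l = i then U else W"] that
    by (auto simp: Int_commute mult.commute)
  show "indep_var N1 X1 N2 X2"
    by (rule indep_var_vimageI[OF X(1,2)], rule pair[of 0 1]) (auto simp: F_def)
  show "indep_var N1 X1 N3 X3"
    by (rule indep_var_vimageI[OF X(1,3)], rule pair[of 0 2]) (auto simp: F_def)
  show "indep_var N2 X2 N3 X3"
    by (rule indep_var_vimageI[OF X(2,3)], rule pair[of 1 2]) (auto simp: F_def)
qed

section \<open>Covariances and the variance of a linear combination\<close>

lemma (in prob_space) indep_var_covariance:
  fixes X Y :: "'a \<Rightarrow> real"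
  assumes indep: "indep_var borel X borel Y" and X: "integrable M X" and Y: "integrable M Y"
  shows "integrable M (\<lambda>x. (X x - expectation X) * (Y x - expectation Y))"
    and "expectation (\<lambda>x. (X x - expectation X) * (Y x - expectation Y)) = 0"
proof -
  have indep': "indep_var borel (\<lambda>x. X x - expectation X) borel (\<lambda>x. Y x - expectation Y)"
    using indep_var_compose[OF indep, of "\<lambda>x. x - expectation X" borel "\<lambda>x. x - expectation Y" borel]
    by (simp add: comp_def)
  note I = indep' Bochner_Integration.integrable_diff[OF X integrable_const]
    Bochner_Integration.integrable_diff[OF Y integrable_const]
  show "integrable M (\<lambda>x. (X x - expectation X) * (Y x - expectation Y))"
    by (rule indep_var_integrable[OF I])
  show "expectation (\<lambda>x. (X x - expectation X) * (Y x - expectation Y)) = 0"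
    using X Y by (subst indep_var_lebesgue_integral[OF I]) (simp add: prob_space)
qed

lemma (in prob_space) square_integrable_centered:
  fixes X :: "'a \<Rightarrow> real"
  assumes X: "integrable M X" and X2: "integrable M (\<lambda>x. (X x)\<^sup>2)"
  shows "integrable M (\<lambda>x. (X x - c)\<^sup>2)"
  using X X2 by (simp add: power2_diff)

lemma (in prob_space) variance_diff_const:
  fixes X :: "'a \<Rightarrow> real"
  assumes "integrable M X"
  shows "variance (\<lambda>x. X x - c) = variance X"
  using assms by (simp add: prob_space algebra_simps)

text \<open>Centering removes \<open>d\<close>; in the expanded square the mixed terms are
  covariances, which vanish by pairwise independence.\<close>

lemma (in prob_space) variance_linear_combination3:
  fixes X Y Z :: "'a \<Rightarrow> real"
  assumes indep: "indep_var borel X borel Y" "indep_var borel X borel Z" "indep_var borel Y borel Z"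
    and int: "integrable M X" "integrable M Y" "integrable M Z"
    and int2: "integrable M (\<lambda>x. (X x)\<^sup>2)" "integrable M (\<lambda>x. (Y x)\<^sup>2)" "integrable M (\<lambda>x. (Z x)\<^sup>2)"
  shows "variance (\<lambda>x. a * X x + b * Y x + c * Z x - d)
    = a\<^sup>2 * variance X + b\<^sup>2 * variance Y + c\<^sup>2 * variance Z"
proof -
  define x y z where "x = (\<lambda>\<omega>. X \<omega> - expectation X)" and "y = (\<lambda>\<omega>. Y \<omega> - expectation Y)"
    and "z = (\<lambda>\<omega>. Z \<omega> - expectation Z)"
  have sq: "integrable M (\<lambda>\<omega>. (x \<omega>)\<^sup>2)" "integrable M (\<lambda>\<omega>. (y \<omega>)\<^sup>2)" "integrable M (\<lambda>\<omega>. (z \<omega>)\<^sup>2)"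
    unfolding x_def y_def z_def using int int2 by (auto intro!: square_integrable_centered)
  have cov: "integrable M (\<lambda>\<omega>. x \<omega> * y \<omega>)" "integrable M (\<lambda>\<omega>. x \<omega> * z \<omega>)"
    "integrable M (\<lambda>\<omega>. y \<omega> * z \<omega>)"
    and cov0: "expectation (\<lambda>\<omega>. x \<omega> * y \<omega>) = 0" "expectation (\<lambda>\<omega>. x \<omega> * z \<omega>) = 0"
    "expectation (\<lambda>\<omega>. y \<omega> * z \<omega>) = 0"
    unfolding x_def y_def z_def using indep int by (auto intro!: indep_var_covariance)
  have E: "expectation (\<lambda>x. a * X x + b * Y x + c * Z x - d)
      = a * expectation X + b * expectation Y + c * expectation Z - d"
    using int by (simp add: prob_space)
  have "variance (\<lambda>x. a * X x + b * Y x + c * Z x - d)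
      = expectation (\<lambda>\<omega>. a\<^sup>2 * (x \<omega>)\<^sup>2 + b\<^sup>2 * (y \<omega>)\<^sup>2 + c\<^sup>2 * (z \<omega>)\<^sup>2
          + 2 * a * b * (x \<omega> * y \<omega>) + 2 * a * c * (x \<omega> * z \<omega>) + 2 * b * c * (y \<omega> * z \<omega>))"
    unfolding E x_def y_def z_def
    by (intro Bochner_Integration.integral_cong) (auto simp: power2_eq_square algebra_simps)
  also have "\<dots> = a\<^sup>2 * expectation (\<lambda>\<omega>. (x \<omega>)\<^sup>2) + b\<^sup>2 * expectation (\<lambda>\<omega>. (y \<omega>)\<^sup>2)
      + c\<^sup>2 * expectation (\<lambda>\<omega>. (z \<omega>)\<^sup>2)"
    using sq cov cov0 by simp
  finally show ?thesis unfolding x_def y_def z_def .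
qed

section \<open>The cost as a quadratic polynomial in \<beta>\<close>

theorem proposition3p7:
  fixes M :: "'a measure" and T \<sigma>\<^sub>V \<sigma>\<^sub>\<phi> \<rho> \<beta>_opt :: real and V \<phi> :: "nat \<Rightarrow> real" and k :: nat
    and w\<^sub>V w\<^sub>\<phi> w\<^sub>r w\<^sub>x :: "nat \<Rightarrow> 'a \<Rightarrow> real"
  defines "Vm \<equiv> \<lambda>\<omega>. V k + w\<^sub>V k \<omega>"
    and "\<phi>m \<equiv> \<lambda>\<omega>. \<phi> k + w\<^sub>\<phi> k \<omega>"
  defines "w \<equiv> \<lambda>\<beta> \<omega>. (1 - \<beta>) * w\<^sub>r (Suc k) \<omega> + \<beta> * w\<^sub>x k \<omega>
                  + \<beta> * T * Vm \<omega> * cos (\<phi>m \<omega>) - \<beta> * T * V k * cos (\<phi> k)"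
  defines "\<mu> \<equiv> \<lambda>\<beta>. prob_space.expectation M (w \<beta>)"
    and "\<sigma>2 \<equiv> \<lambda>\<beta>. prob_space.variance M (w \<beta>)"
  defines "J \<equiv> \<lambda>\<beta>. \<rho> * (\<mu> \<beta>)\<^sup>2 + (1 - \<rho>) * \<sigma>2 \<beta>"
  defines "v\<^sub>r \<equiv> \<lambda>\<omega>. w\<^sub>r (Suc k) \<omega> - prob_space.expectation M (w\<^sub>r (Suc k))"
    and "v\<^sub>x \<equiv> \<lambda>\<omega>. w\<^sub>x k \<omega> - prob_space.expectation M (w\<^sub>x k)"
    and "v\<^sub>v \<equiv> \<lambda>\<omega>. T * Vm \<omega> * cos (\<phi>m \<omega>) - T * V k * cos (\<phi> k) * exp (- \<sigma>\<^sub>\<phi>\<^sup>2 / 2)"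
  defines "\<eta> \<equiv> prob_space.variance M v\<^sub>r + prob_space.variance M v\<^sub>x + prob_space.variance M v\<^sub>v"
    and "\<gamma> \<equiv> - prob_space.expectation M (w\<^sub>r (Suc k)) + prob_space.expectation M (w\<^sub>x k)
              + T * V k * cos (\<phi> k) * (exp (- \<sigma>\<^sub>\<phi>\<^sup>2 / 2) - 1)"
  defines "\<xi> \<equiv> (2 * (1 - \<rho>) * prob_space.variance M v\<^sub>r
                 - 2 * \<rho> * \<gamma> * prob_space.expectation M (w\<^sub>r (Suc k)))
              / (2 * (1 - \<rho>) * \<eta> + 2 * \<rho> * \<gamma>\<^sup>2)"
  assumes "prob_space M"
    and "T > 0" and "\<sigma>\<^sub>V \<ge> 0" and "\<sigma>\<^sub>\<phi> \<ge> 0"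
    and "gaussian_rv M (w\<^sub>V k) 0 \<sigma>\<^sub>V" and "gaussian_rv M (w\<^sub>\<phi> k) 0 \<sigma>\<^sub>\<phi>"
    and "prob_space.indep_var M borel (w\<^sub>V k) borel (w\<^sub>\<phi> k)"
    and "integrable M (\<lambda>\<omega>. (w\<^sub>r (Suc k) \<omega>)\<^sup>2)" and "integrable M (\<lambda>\<omega>. (w\<^sub>x k \<omega>)\<^sup>2)"
    and "indep_vars3 M borel (w\<^sub>r (Suc k)) borel (w\<^sub>x k)
           (borel \<Otimes>\<^sub>M borel) (\<lambda>\<omega>. (Vm \<omega>, \<phi>m \<omega>))"
    and "\<rho> \<in> {0..1}"
    and "(1 - \<rho>) * \<eta> + \<rho> * \<gamma>\<^sup>2 \<noteq> 0"
  shows "is_arg_min J (\<lambda>\<beta>. \<beta> \<in> {-1..1}) \<beta>_opt \<longleftrightarrow> \<beta>_opt = max (-1) (min \<xi> 1)"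
proof -
  interpret prob_space M by fact
  let ?R = "w\<^sub>r (Suc k)" and ?X = "w\<^sub>x k"
  let ?Z = "\<lambda>\<omega>. T * Vm \<omega> * cos (\<phi>m \<omega>)"
  note GV = \<open>gaussian_rv M (w\<^sub>V k) 0 \<sigma>\<^sub>V\<close> and G\<phi> = \<open>gaussian_rv M (w\<^sub>\<phi> k) 0 \<sigma>\<^sub>\<phi>\<close>
  have [measurable]: "w\<^sub>V k \<in> borel_measurable M" "w\<^sub>\<phi> k \<in> borel_measurable M"
    using GV G\<phi> by (auto simp: gaussian_rv_def)
  have [measurable]: "Vm \<in> borel_measurable M" "\<phi>m \<in> borel_measurable M"
    unfolding Vm_def \<phi>m_def by measurable
  \<comment> \<open>The error depends on the measured pair only through the displacement
    \<open>?Z\<close>, a measurable function of that pair.\<close>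
  have "(\<lambda>p. T * fst p * cos (snd p)) \<in> borel_measurable (borel \<Otimes>\<^sub>M borel)"
    by measurable
  note indep_vars3_compose[OF \<open>indep_vars3 M _ _ _ _ _ _\<close> measurable_ident measurable_ident this]
  then have "indep_vars3 M borel ?R borel ?X borel ?Z" by (simp add: comp_def)
  note RX = indep_vars3_pairwise(1)[OF this] and RZ = indep_vars3_pairwise(2)[OF this]
    and XZ = indep_vars3_pairwise(3)[OF this]
  have [measurable]: "?R \<in> borel_measurable M" "?X \<in> borel_measurable M"
    using indep_var_rv1[OF RX] indep_var_rv2[OF RX] by auto

  have V2: "integrable M (\<lambda>\<omega>. (w\<^sub>V k \<omega>)\<^sup>2)"
    using gaussian_rv_square_integrable[OF GV \<open>\<sigma>\<^sub>V \<ge> 0\<close>] .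
  have V1: "integrable M (w\<^sub>V k)"
    by (rule square_integrable_imp_integrable[OF _ V2]) measurable
  have Vm1: "integrable M Vm" and Vm2: "integrable M (\<lambda>\<omega>. (Vm \<omega>)\<^sup>2)"
    using V1 V2 by (auto simp: Vm_def power2_sum)
  \<comment> \<open>Since the cosine is bounded by 1, \<open>?Z\<close> is dominated by
    \<open>T\<close> times the measured speed, which has a second moment.\<close>
  have Z2: "integrable M (\<lambda>\<omega>. (?Z \<omega>)\<^sup>2)"
  proof (rule Bochner_Integration.integrable_bound)
    show "integrable M (\<lambda>\<omega>. T\<^sup>2 * (Vm \<omega>)\<^sup>2)" using Vm2 by simp
    show "AE \<omega> in M. norm ((?Z \<omega>)\<^sup>2) \<le> norm (T\<^sup>2 * (Vm \<omega>)\<^sup>2)"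
      by (auto simp: power_mult_distrib abs_mult abs_square_le_1 intro!: mult_left_le)
  qed measurable
  have R2: "integrable M (\<lambda>\<omega>. (?R \<omega>)\<^sup>2)" and X2: "integrable M (\<lambda>\<omega>. (?X \<omega>)\<^sup>2)" by fact+
  have int: "integrable M ?R" "integrable M ?X" "integrable M ?Z"
    using R2 X2 Z2 by (auto intro!: square_integrable_imp_integrable)

  \<comment> \<open>Speed and orientation noise are independent, hence so are these functions of
    them, and the expectation of the displacement factors.\<close>
  have "indep_var borel Vm borel (\<lambda>\<omega>. cos (\<phi>m \<omega>))"
    using indep_var_compose[OF \<open>indep_var borel (w\<^sub>V k) borel (w\<^sub>\<phi> k)\<close>,
        of "\<lambda>v. V k + v" borel "\<lambda>p. cos (\<phi> k + p)" borel]
    by (simp add: comp_def Vm_def \<phi>m_def)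
  moreover have "integrable M (\<lambda>\<omega>. cos (\<phi>m \<omega>))"
    by (rule integrable_const_bound[of _ 1]) auto
  ultimately have "expectation (\<lambda>\<omega>. Vm \<omega> * cos (\<phi>m \<omega>)) = expectation Vm * expectation (\<lambda>\<omega>. cos (\<phi>m \<omega>))"
    using Vm1 by (intro indep_var_lebesgue_integral)
  moreover have "expectation Vm = V k"
    using V1 gaussian_rv_expectation[OF GV \<open>\<sigma>\<^sub>V \<ge> 0\<close>] by (simp add: Vm_def prob_space)
  moreover have "expectation (\<lambda>\<omega>. cos (\<phi>m \<omega>)) = cos (\<phi> k) * exp (- \<sigma>\<^sub>\<phi>\<^sup>2 / 2)"
    unfolding \<phi>m_def by (rule gaussian_rv_expectation_cos[OF G\<phi> \<open>\<sigma>\<^sub>\<phi> \<ge> 0\<close>])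
  ultimately have EZ: "expectation ?Z = T * V k * cos (\<phi> k) * exp (- \<sigma>\<^sub>\<phi>\<^sup>2 / 2)"
    by (simp add: mult.assoc)

  have w: "w \<beta> = (\<lambda>\<omega>. (1 - \<beta>) * ?R \<omega> + \<beta> * ?X \<omega> + \<beta> * ?Z \<omega> - \<beta> * T * V k * cos (\<phi> k))" for \<beta>
    by (simp add: w_def mult.assoc)
  \<comment> \<open>\<open>\<gamma>\<close> collects the coefficient of \<beta>: the bias of
    \<open>?X\<close> minus that of \<open>?R\<close>, plus the expected measured displacement minus
    the true one. The last difference produces the factor
    \<open>exp (- \<sigma>\<^sub>\<phi>\<^sup>2 / 2) - 1\<close>.\<close>
  have \<mu>: "\<mu> \<beta> = expectation ?R + \<beta> * \<gamma>" for \<beta>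
  proof -
    have "\<mu> \<beta> = (1 - \<beta>) * expectation ?R + \<beta> * expectation ?X + \<beta> * expectation ?Z
        - \<beta> * T * V k * cos (\<phi> k)"
      unfolding \<mu>_def w using int by (simp add: prob_space)
    then show ?thesis unfolding EZ \<gamma>_def by (simp add: algebra_simps)
  qed
  \<comment> \<open>Each centered variable differs from \<open>?R\<close>, \<open>?X\<close> or
    \<open>?Z\<close> by a constant.\<close>
  have var: "variance v\<^sub>r = variance ?R" "variance v\<^sub>x = variance ?X" "variance v\<^sub>v = variance ?Z"
    unfolding v\<^sub>r_def v\<^sub>x_def v\<^sub>v_def using int by (simp_all only: variance_diff_const)
  have \<sigma>2: "\<sigma>2 \<beta> = (1 - \<beta>)\<^sup>2 * variance v\<^sub>r + \<beta>\<^sup>2 * variance v\<^sub>x + \<beta>\<^sup>2 * variance v\<^sub>v" for \<beta>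
    unfolding \<sigma>2_def w var
    by (rule variance_linear_combination3[OF RX RZ XZ int R2 X2 Z2])

  \<comment> \<open>\<open>D\<close> is the leading coefficient of \<open>J\<close>. It is a
    nonnegative combination of \<open>\<eta>\<close> and \<open>\<gamma>\<^sup>2\<close>, so the
    nonvanishing assumption makes it positive.\<close>
  define D where "D = (1 - \<rho>) * \<eta> + \<rho> * \<gamma>\<^sup>2"
  have "\<eta> \<ge> 0" unfolding \<eta>_def by (intro add_nonneg_nonneg variance_positive)
  then have "D \<ge> 0" using \<open>\<rho> \<in> {0..1}\<close> by (simp add: D_def)
  then have "D > 0" using \<open>(1 - \<rho>) * \<eta> + \<rho> * \<gamma>\<^sup>2 \<noteq> 0\<close> by (simp add: D_def)
  \<comment> \<open>The linear coefficient of \<open>J\<close> is \<open>- 2 * N\<close>, so the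
    vertex is \<open>N / D\<close>, which is \<open>\<xi>\<close> after cancelling 2.\<close>
  define N where "N = (1 - \<rho>) * variance v\<^sub>r - \<rho> * \<gamma> * expectation ?R"
  have "\<xi> = (2 * N) / (2 * D)"
    unfolding \<xi>_def N_def D_def by (simp add: algebra_simps)
  then have \<xi>: "D * \<xi> = N" using \<open>D > 0\<close> by simp
  \<comment> \<open>Completing the square; the constant term of the polynomial is expressed as
    \<open>J 0\<close>.\<close>
  have "J \<beta> = (J 0 - D * \<xi>\<^sup>2) + D * (\<beta> - \<xi>)\<^sup>2" for \<beta>
  proof -
    have "J \<beta> = J 0 - 2 * \<beta> * N + D * \<beta>\<^sup>2"
      unfolding J_def \<mu> \<sigma>2 N_def D_def \<eta>_def by (simp add: power2_eq_square algebra_simps)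
    also have "\<dots> = (J 0 - D * \<xi>\<^sup>2) + D * (\<beta> - \<xi>)\<^sup>2"
      unfolding \<xi>[symmetric] by (simp add: power2_eq_square algebra_simps)
    finally show ?thesis .
  qed
  then show ?thesis
    by (rule is_arg_min_quadratic_interval) (use \<open>D > 0\<close> in auto)
qed

end
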